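(* Let $s,n,m\ge 1$, let $h>0$, let $k\in\mathbb{N}$, and let $0\le c_i\le 1$, $i=1,\dots,s$, be $s$ (pairwise distinct) collocation points. Let $\mathbf{J}^k=\mathrm{blockdiag}(\mathbf{J}^k_1,\dots,\mathbf{J}^k_s)=-(\mathbf{J}^k)^T\in\mathbb{R}^{sn\times sn}$, $\mathbf{G}^k=\mathrm{blockdiag}(\mathbf{G}^k_1,\dots,\mathbf{G}^k_s)\in\mathbb{R}^{sn\times sm}$ and the symmetric matrix $\mathbf{M}=(m_{ij})_{i,j=1}^s\otimes \mathbf{I}_n\in\mathbb{R}^{sn\times sn}$ be as defined in the context. Suppose that at least one of the following two conditions holds: (C1) $m_{ij}=0$ for all $i\neq j$; (C2) $\mathbf{J}^k_i=\mathbf{J}^k_j=\text{const.}$ for all $i,j=1,\dots,s$. Then the system of equations $$-\mathbf{f}^k=\mathbf{J}^k\mathbf{e}^k+\mathbf{G}^k\mathbf{u}^k,\qquad \mathbf{y}^k=(\mathbf{G}^k)^T\mathbf{M}\,\mathbf{e}^k,$$ with discrete flow, effort, input and output vectors $\mathbf{f}^k,\mathbf{e}^k\in\mathbb{R}^{sn}$, $\mathbf{u}^k,\mathbf{y}^k\in\mathbb{R}^{sm}$, represents a discrete-time Dirac structure on the time interval $I^k=[(k-1)h,kh]$; that is, the set $$\mathcal{D}^k=\left\{\big((\mathbf{f}^k,\mathbf{y}^k),(\mathbf{M}\mathbf{e}^k,\mathbf{u}^k)\big)\;:\;-\mathbf{f}^k=\mathbf{J}^k\mathbf{e}^k+\mathbf{G}^k\mathbf{u}^k,\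 \mathbf{y}^k=(\mathbf{G}^k)^T\mathbf{M}\,\mathbf{e}^k\right\}$$ is a Dirac structure in $\mathbb{R}^{s(n+m)}\times\mathbb{R}^{s(n+m)}$.
   Context: Underlying continuous-time system: an explicit lossless port-Hamiltonian system $\dot{\mathbf{x}}=\mathbf{J}(\mathbf{x})\nabla H(\mathbf{x})+\mathbf{G}(\mathbf{x})\mathbf{u}$, $\mathbf{y}=\mathbf{G}^T(\mathbf{x})\nabla H(\mathbf{x})$, with $\mathbf{x}\in\mathbb{R}^n$, $\mathbf{u},\mathbf{y}\in\mathbb{R}^m$, $\mathbf{J}(\mathbf{x})=-\mathbf{J}(\mathbf{x})^T\in\mathbb{R}^{n\times n}$, $\mathbf{G}(\mathbf{x})\in\mathbb{R}^{n\times m}$. Let $\mathbf{x}^k_i\in\mathbb{R}^n$, $i=1,\dots,s$, be the numerical stage values at the times $t^k_i=(k-1)h+c_ih$. Set $\mathbf{J}^k_i=\mathbf{J}(\mathbf{x}^k_i)=-(\mathbf{J}^k_i)^T$ and $\mathbf{G}^k_i=\mathbf{G}(\mathbf{x}^k_i)$. For the Dirac structure, $\mathbf{J}^k$ and $\mathbf{G}^k$ are treated as given matrices on the interval $I^k$, and $\mathbf{f}^k,\mathbf{e}^k,\mathbf{u}^k,\mathbf{y}^k$ as free vectors subject only to the stated equations. These vectors are stacked from the coordinates at the collocation points: $\mathbf{f}^k=((\mathbf{f}^k_1)^T,\dots,(\mathbf{f}^k_s)^T)^T$ with $\mathbf{f}_i^k\in\mathbb{R}^n$, and analogously $\mathbf{e}^k$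 (blocks in $\mathbb{R}^n$), $\mathbf{u}^k$ and $\mathbf{y}^k$ (blocks in $\mathbb{R}^m$). The Lagrange polynomials are $\ell_i(\tau)=\prod_{j\ne i}\frac{\tau-c_j}{c_i-c_j}$, $\tau\in[0,1]$, and $m_{ij}=\int_0^1\ell_i(\sigma)\ell_j(\sigma)\,d\sigma$. $\otimes$ is the Kronecker product and $\mathbf{I}_n$ the $n\times n$ identity matrix. Dirac structure: on $\mathcal{F}\times\mathcal{E}=\mathbb{R}^N\times\mathbb{R}^N$, a linear subspace $\mathcal{D}\subset\mathcal{F}\times\mathcal{E}$ is a Dirac structure if $\mathcal{D}=\mathcal{D}^{\perp}$, where $\perp$ is the orthogonal complement with respect to the symmetric bilinear form $\langle\langle(\phi_1,\epsilon_1),(\phi_2,\epsilon_2)\rangle\rangle=\epsilon_1^T\phi_2+\epsilon_2^T\phi_1$. Equivalently, $\dim\mathcal{D}=N$ and $\epsilon^T\phi=0$ for all $(\phi,\epsilon)\in\mathcal{D}$. Here $N=s(n+m)$, $\phi=(\mathbf{f}^k,\mathbf{y}^k)$ and $\epsilon=(\mathbf{M}\mathbf{e}^k,\mathbf{u}^k)$. *)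

theory Defs
  imports "HOL-Analysis.Analysis"
begin

text \<open>
  Stacked vectors with blocks \<open>i = 1, \<dots>, s\<close> in \<open>\<real>\<^sup>n\<close> are indexed by pairs: the \<open>a\<close>-th coordinate
  of the \<open>i\<close>-th block of \<open>v :: real ^ ('s \<times> 'n)\<close> is \<open>v $ (i, a)\<close>. A matrix with \<open>p\<close> rows and \<open>q\<close>
  columns has type \<open>real ^ 'q ^ 'p\<close>.
\<close>

definition blockdiag :: "('s::finite \<Rightarrow> real ^ 'q ^ 'p) \<Rightarrow> real ^ ('s \<times> 'q) ^ ('s \<times> 'p)" where
  "blockdiag B = (\<chi> r. \<chi> t. if fst r = fst t then B (fst r) $ snd r $ snd t else 0)"

definition kronecker :: "real ^ 'b ^ 'a \<Rightarrow> real ^ 'q ^ 'p \<Rightarrow> real ^ ('b \<times> 'q) ^ ('a \<times> 'p)" where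
  "kronecker A B = (\<chi> r. \<chi> t. A $ fst r $ fst t * B $ snd r $ snd t)"

definition lagrange_basis :: "('s::finite \<Rightarrow> real) \<Rightarrow> 's \<Rightarrow> real \<Rightarrow> real" where
  "lagrange_basis c i \<tau> = (\<Prod>j\<in>UNIV - {i}. (\<tau> - c j) / (c i - c j))"

definition lagrange_mass :: "('s::finite \<Rightarrow> real) \<Rightarrow> real ^ 's ^ 's" where
  "lagrange_mass c =
     (\<chi> i. \<chi> j. integral {0..1} (\<lambda>\<sigma>. lagrange_basis c i \<sigma> * lagrange_basis c j \<sigma>))"

text \<open>Elements of \<open>\<F> \<times> \<E>\<close> are pairs (flow, effort).\<close>

definition dirac_pairing :: "'a::euclidean_space \<times> 'a \<Rightarrow> 'a \<times> 'a \<Rightarrow> real" where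
  "dirac_pairing p q = snd p \<bullet> fst q + snd q \<bullet> fst p"

definition dirac_orthogonal :: "('a::euclidean_space \<times> 'a) set \<Rightarrow> ('a \<times> 'a) set" where
  "dirac_orthogonal D = {p. \<forall>q\<in>D. dirac_pairing p q = 0}"

definition dirac_structure :: "('a::euclidean_space \<times> 'a) set \<Rightarrow> bool" where
  "dirac_structure D \<longleftrightarrow> subspace D \<and> D = dirac_orthogonal D"

text \<open>
  The space \<open>\<real>\<^sup>N\<close>, \<open>N = s (n + m)\<close>, of pairs such as \<open>(f, y)\<close> is the product Euclidean space
  \<open>real ^ ('s \<times> 'n) \<times> real ^ ('s \<times> 'm)\<close>; its inner product is the sum of those of the two factors.
\<close>

lemma DIM_stacked_ports:
  "DIM((real ^ ('s::finite \<times> 'n::finite)) \<times> (real ^ ('s \<times> 'm::finite)))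
     = CARD('s) * (CARD('n) + CARD('m))"
  by (simp add: distrib_left)

definition discrete_structure ::
  "real ^ 'e ^ 'e \<Rightarrow> real ^ 'u ^ 'e \<Rightarrow> real ^ 'e ^ 'e \<Rightarrow>
     (((real ^ 'e) \<times> (real ^ 'u)) \<times> ((real ^ 'e) \<times> (real ^ 'u))) set" where
  "discrete_structure J G M =
     {((f, y), (M *v e, u)) | f y e u.
        - f = J *v e + G *v u \<and> y = (transpose G ** M) *v e}"

end

theory Submission
  imports Defs
begin

text \<open>
  If \<open>M\<close> is symmetric, the pairing of two elements of the relation with parameters \<open>(e\<^sub>1, u\<^sub>1)\<close> and
  \<open>(e\<^sub>2, u\<^sub>2)\<close> reduces to \<open>- (e\<^sub>1\<^sup>T M J e\<^sub>2 + e\<^sub>2\<^sup>T M J e\<^sub>1)\<close>, as the terms with \<open>G\<close> cancel. So the relation is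
  isotropic once \<open>M J\<close> is skew, and each of the two conditions gives this, since the block \<open>(i, j)\<close>
  of \<open>M J\<close> is \<open>m\<^bsub>ij\<^esub> J\<^sub>j\<close>. For maximality, \<open>M\<close> must be invertible: it comes from the Gram matrix of
  the Lagrange polynomials in \<open>L\<^sup>2[0, 1]\<close>, and a combination of these with zero norm vanishes at all
  collocation points, where its values are its coefficients.
\<close>

lemma invertible_eq_zero_kernel:
  fixes A :: "real ^ 'n ^ 'n"
  shows "invertible A \<longleftrightarrow> (\<forall>v. A *v v = 0 \<longrightarrow> v = 0)"
  by (simp add: invertible_left_inverse matrix_left_invertible_ker)

lemma dirac_pairing_diff_left:
  "dirac_pairing (p - p') q = dirac_pairing p q - dirac_pairing p' q"
  by (simp add: dirac_pairing_def inner_diff)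

text \<open>Solving for \<open>f\<close> and keeping \<open>w = M *v e\<close> as an equation leaves
  \<open>e\<close> as the only unknown, so membership reduces to naming one witness.\<close>

lemma mem_discrete_structure:
  "((f, y), (w, u)) \<in> discrete_structure J G M \<longleftrightarrow>
     (\<exists>e. f = - (J *v e + G *v u) \<and> y = (transpose G ** M) *v e \<and> w = M *v e)"
proof -
  have "- f = z \<longleftrightarrow> f = - z" for z by auto
  then show ?thesis unfolding discrete_structure_def by auto
qed

lemma subspace_discrete_structure: "subspace (discrete_structure J G M)"
proof (rule subspaceI)
  show "0 \<in> discrete_structure J G M"
    unfolding zero_prod_def mem_discrete_structure by (intro exI[of _ 0]) simp
next
  fix p q assume "p \<in> discrete_structure J G M" "q \<in> discrete_structure J G M"
  then obtain e u e' u' where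
    "p = ((- (J *v e + G *v u), (transpose G ** M) *v e), (M *v e, u))"
    "q = ((- (J *v e' + G *v u'), (transpose G ** M) *v e'), (M *v e', u'))"
    by (cases p; cases q) (auto simp: mem_discrete_structure)
  then show "p + q \<in> discrete_structure J G M"
    by (auto simp: mem_discrete_structure matrix_vector_right_distrib intro!: exI[of _ "e + e'"])
next
  fix a p assume "p \<in> discrete_structure J G M"
  then obtain e u where
    "p = ((- (J *v e + G *v u), (transpose G ** M) *v e), (M *v e, u))"
    by (cases p) (auto simp: mem_discrete_structure)
  then show "a *\<^sub>R p \<in> discrete_structure J G M"
    by (auto simp: mem_discrete_structure matrix_vector_mult_scaleR scaleR_diff_right
        intro!: exI[of _ "a *\<^sub>R e"])
qed

lemma dirac_pairing_discrete_structure: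
  fixes J M :: "real ^ 'e ^ 'e" and G :: "real ^ 'u ^ 'e"
  assumes sym: "transpose M = M" and skew: "transpose (M ** J) = - (M ** J)"
    and p: "p \<in> discrete_structure J G M" and q: "q \<in> discrete_structure J G M"
  shows "dirac_pairing p q = 0"
proof -
  from p obtain e u where p: "p = ((- (J *v e + G *v u), (transpose G ** M) *v e), (M *v e, u))"
    by (cases p) (auto simp: mem_discrete_structure)
  from q obtain e' u' where q: "q = ((- (J *v e' + G *v u'), (transpose G ** M) *v e'), (M *v e', u'))"
    by (cases q) (auto simp: mem_discrete_structure)
  \<comment> \<open>Symmetry of \<open>M\<close> moves it across the inner product, so
    \<open>J\<close> enters only through \<open>M ** J\<close>. In the pairing, each
    \<open>G\<close> term of an output cancels the one of the other element's flow, which has the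
    opposite sign.\<close>
  have J: "(M *v a) \<bullet> (J *v b) = a \<bullet> ((M ** J) *v b)" for a b
    by (metis dot_lmul_matrix matrix_vector_mul_assoc sym transpose_matrix_vector)
  have G: "u \<bullet> ((transpose G ** M) *v a) = (M *v a) \<bullet> (G *v u)" for u a
    by (metis dot_lmul_matrix inner_commute matrix_vector_mul_assoc transpose_matrix_vector)
  have "e \<bullet> ((M ** J) *v e') = (transpose (M ** J) *v e) \<bullet> e'"
    by (metis dot_lmul_matrix transpose_matrix_vector)
  also have "\<dots> = - (e' \<bullet> ((M ** J) *v e))"
    by (simp add: skew inner_commute scaleR_matrix_vector_assoc[of "-1", simplified, symmetric])
  finally show ?thesis
    unfolding p q dirac_pairing_def by (simp add: inner_add_right inner_diff_right J G)
qed

lemma dirac_structure_discrete_structure: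
  fixes J M :: "real ^ 'e ^ 'e" and G :: "real ^ 'u ^ 'e"
  assumes sym: "transpose M = M" and inv: "invertible M"
    and skew: "transpose (M ** J) = - (M ** J)"
  shows "dirac_structure (discrete_structure J G M)"
proof -
  have onto: "\<exists>e. M *v e = w" for w
    using inv by (metis invertible_right_inverse matrix_right_invertible_surjective surj_def)
  have "p \<in> discrete_structure J G M" if p: "p \<in> dirac_orthogonal (discrete_structure J G M)" for p
  proof -
    obtain f y w u where p_eq: "p = ((f, y), (w, u))" by (metis surj_pair)
    obtain e where e: "M *v e = w" using onto by blast
    \<comment> \<open>The member \<open>p'\<close> has the same effort part as \<open>p\<close>. By
      isotropy it is orthogonal to the relation, hence so is \<open>p - p'\<close>, which is a pure
      flow.\<close>
    define p' where "p' = ((- (J *v e + G *v u), (transpose G ** M) *v e), (w, u))"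
    have p': "p' \<in> discrete_structure J G M"
      unfolding p'_def mem_discrete_structure using e by blast
    define f' where "f' = fst (fst (p - p'))"
    define y' where "y' = snd (fst (p - p'))"
    have pp: "p - p' = ((f', y'), 0)"
      by (simp add: p_eq p'_def f'_def y'_def)
    \<comment> \<open>Surjectivity of \<open>M\<close> gives a member \<open>?q\<close> whose effort
      is the flow \<open>(f', y')\<close>. The effort of \<open>p - p'\<close> being zero, the
      pairing with \<open>?q\<close> is the squared norm of that flow.\<close>
    obtain e' where e': "M *v e' = f'" using onto by blast
    have "((- (J *v e' + G *v y'), (transpose G ** M) *v e'), (f', y')) \<in> discrete_structure J G M"
      (is "?q \<in> _")
      unfolding mem_discrete_structure using e' by blast
    then have "dirac_pairing (p - p') ?q = 0"
      using p dirac_pairing_discrete_structure[OF sym skew p']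
      by (simp add: dirac_pairing_diff_left dirac_orthogonal_def)
    then have "f' = 0 \<and> y' = 0"
      by (simp add: pp dirac_pairing_def add_nonneg_eq_0_iff)
    then have "p = p'" using pp by (metis eq_iff_diff_eq_0 zero_prod_def)
    then show ?thesis using p' by simp
  qed
  then have "discrete_structure J G M = dirac_orthogonal (discrete_structure J G M)"
    using dirac_pairing_discrete_structure[OF sym skew] by (auto simp: dirac_orthogonal_def)
  then show ?thesis
    by (simp add: dirac_structure_def subspace_discrete_structure)
qed

lemma lagrange_basis_node:
  assumes "inj c"
  shows "lagrange_basis c i (c j) = (if i = j then 1 else 0)"
  using assms by (auto simp: lagrange_basis_def inj_eq intro: prod.neutral)

lemma continuous_on_lagrange_basis: "continuous_on S (lagrange_basis c i)"
proof -
  \<comment> \<open>Multiplying by constant inverses avoids the side condition of nonzero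
    denominators, so the nodes may coincide here.\<close>
  have "lagrange_basis c i = (\<lambda>\<tau>. \<Prod>j\<in>UNIV - {i}. (\<tau> - c j) * inverse (c i - c j))"
    by (simp add: lagrange_basis_def fun_eq_iff divide_inverse)
  then show ?thesis by (auto intro!: continuous_intros)
qed

lemma transpose_lagrange_mass: "transpose (lagrange_mass c) = lagrange_mass c"
  by (simp add: transpose_def lagrange_mass_def vec_eq_iff mult.commute)

lemma lagrange_mass_quadratic_form:
  "v \<bullet> (lagrange_mass c *v v) =
     integral {0..1} (\<lambda>\<sigma>. (\<Sum>i\<in>UNIV. v $ i * lagrange_basis c i \<sigma>)\<^sup>2)"
proof -
  have int: "(\<lambda>\<sigma>. v $ i * (v $ j * (lagrange_basis c i \<sigma> * lagrange_basis c j \<sigma>))) integrable_on {0..1}"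
    for i j
    by (intro integrable_continuous_interval continuous_intros continuous_on_lagrange_basis)
  have "integral {0..1} (\<lambda>\<sigma>. (\<Sum>i\<in>UNIV. v $ i * lagrange_basis c i \<sigma>)\<^sup>2) =
     integral {0..1} (\<lambda>\<sigma>. \<Sum>i\<in>UNIV. \<Sum>j\<in>UNIV.
       v $ i * (v $ j * (lagrange_basis c i \<sigma> * lagrange_basis c j \<sigma>)))"
    by (simp add: power2_eq_square sum_product mult_ac)
  also have "\<dots> = (\<Sum>i\<in>UNIV. \<Sum>j\<in>UNIV. v $ i * (v $ j * lagrange_mass c $ i $ j))"
    by (simp add: integral_sum integrable_sum int lagrange_mass_def)
  also have "\<dots> = v \<bullet> (lagrange_mass c *v v)"
    by (simp add: inner_vec_def matrix_vector_mult_def sum_distrib_left mult_ac)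
  finally show ?thesis by simp
qed

lemma invertible_lagrange_mass:
  assumes c: "\<And>i. 0 \<le> c i \<and> c i \<le> 1" and "inj c"
  shows "invertible (lagrange_mass c)"
  unfolding invertible_eq_zero_kernel
proof (intro allI impI)
  fix v assume v: "lagrange_mass c *v v = 0"
  let ?p = "\<lambda>\<sigma>. \<Sum>i\<in>UNIV. v $ i * lagrange_basis c i \<sigma>"
  have "integral {0..1} (\<lambda>\<sigma>. (?p \<sigma>)\<^sup>2) = 0"
    using lagrange_mass_quadratic_form[of v c] v by simp
  moreover have "continuous_on {0..1} (\<lambda>\<sigma>. (?p \<sigma>)\<^sup>2)"
    by (intro continuous_intros continuous_on_lagrange_basis)
  ultimately have "\<forall>\<sigma>\<in>{0..1}. (?p \<sigma>)\<^sup>2 = 0"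
    by (subst (asm) integral_eq_0_iff) auto
  \<comment> \<open>The nodes lie in the interval of integration, and the value of \<open>?p\<close>
    at \<open>c i\<close> is the coefficient \<open>v $ i\<close>.\<close>
  then have "?p (c i) = 0" for i
    using c by simp
  then show "v = 0"
    by (simp add: vec_eq_iff lagrange_basis_node[OF \<open>inj c\<close>] if_distrib cong: if_cong)
qed

text \<open>The identity factor never mixes coordinates within a block: for each fixed
  \<open>a\<close>, the matrix \<open>A\<close> acts on the vector of \<open>a\<close>-th
  coordinates of the blocks. A trivial kernel of \<open>A\<close> thus carries over to the Kronecker
  product.\<close>

lemma kronecker_mat1_component:
  "(kronecker A (mat 1 :: real ^ 'n ^ 'n) *v v) $ (i, a) = (A *v (\<chi> j. v $ (j, a))) $ i"
proof -
  have "(kronecker A (mat 1 :: real ^ 'n ^ 'n) *v v) $ (i, a) =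
      (\<Sum>j\<in>UNIV. \<Sum>b\<in>UNIV. if a = b then A $ i $ j * v $ (j, b) else 0)"
    unfolding sum.cartesian_product matrix_vector_mult_def
    by (auto simp: kronecker_def mat_def split_beta intro!: sum.cong)
  then show ?thesis by (simp add: matrix_vector_mult_def)
qed

lemma invertible_kronecker_mat1:
  fixes A :: "real ^ 's ^ 's"
  assumes "invertible A"
  shows "invertible (kronecker A (mat 1 :: real ^ 'n ^ 'n))"
  unfolding invertible_eq_zero_kernel
proof (intro allI impI)
  fix v assume v: "kronecker A (mat 1 :: real ^ 'n ^ 'n) *v v = 0"
  have "A *v (\<chi> j. v $ (j, a)) = 0" for a
    unfolding vec_eq_iff kronecker_mat1_component[symmetric] v by simp
  then have "(\<chi> j. v $ (j, a)) = 0" for a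
    using assms by (simp add: invertible_eq_zero_kernel)
  then show "v = 0" by (simp add: vec_eq_iff)
qed

lemma transpose_kronecker: "transpose (kronecker A B) = kronecker (transpose A) (transpose B)"
  by (simp add: transpose_def kronecker_def vec_eq_iff)

text \<open>In the sum over the inner index \<open>(l, d)\<close>, the identity forces
  \<open>d = a\<close> and block diagonality forces \<open>l = j\<close>, so a single term
  survives.\<close>

lemma kronecker_mat1_mult_blockdiag:
  "(kronecker A (mat 1 :: real ^ 'n ^ 'n) ** blockdiag B) $ (i, a) $ (j, b) = A $ i $ j * B j $ a $ b"
proof -
  have "(kronecker A (mat 1 :: real ^ 'n ^ 'n) ** blockdiag B) $ (i, a) $ (j, b) =
      (\<Sum>l\<in>UNIV. \<Sum>d\<in>UNIV. if a = d then if l = j then A $ i $ l * B l $ d $ b else 0 else 0)"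
    unfolding sum.cartesian_product matrix_matrix_mult_def
    by (auto simp: kronecker_def blockdiag_def mat_def split_beta intro!: sum.cong)
  then show ?thesis by simp
qed

theorem theorem1:
  fixes J :: "real ^ 'n \<Rightarrow> real ^ 'n ^ 'n"
    and G :: "real ^ 'n \<Rightarrow> real ^ 'm ^ 'n"
    and h :: real and k :: nat
    and c :: "'s::finite \<Rightarrow> real"
    and x :: "nat \<Rightarrow> 's \<Rightarrow> real ^ 'n"
  assumes skew: "\<And>z. J z = - transpose (J z)"
    and "h > 0"
    and "\<And>i. 0 \<le> c i \<and> c i \<le> 1"
    and "inj c"
    and "(\<forall>i j. i \<noteq> j \<longrightarrow> lagrange_mass c $ i $ j = 0) \<or>
         (\<forall>i j. J (x k i) = J (x k j))"
  shows "dirac_structure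
           (discrete_structure
             (blockdiag (\<lambda>i. J (x k i)))
             (blockdiag (\<lambda>i. G (x k i)))
             (kronecker (lagrange_mass c) (mat 1 :: real ^ 'n ^ 'n)))"
proof (rule dirac_structure_discrete_structure)
  let ?m = "lagrange_mass c" and ?B = "\<lambda>i. J (x k i)"
  let ?M = "kronecker ?m (mat 1 :: real ^ 'n ^ 'n)"
  show "transpose ?M = ?M"
    by (simp add: transpose_kronecker transpose_lagrange_mass transpose_mat)
  show "invertible ?M"
    by (rule invertible_kronecker_mat1[OF invertible_lagrange_mass[OF assms(3,4)]])
  have *: "?m $ j $ i * J (x k i) $ b $ a = - (?m $ i $ j * J (x k j) $ a $ b)" for i j a b
  proof -
    have "?m $ j $ i = ?m $ i $ j"
      by (simp add: lagrange_mass_def mult.commute)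
    moreover have "J (x k i) $ b $ a = - J (x k i) $ a $ b"
      by (subst skew) (simp add: transpose_def)
    \<comment> \<open>Within a diagonal block, skewness of \<open>J\<close> suffices. Off the
      diagonal, the first condition makes both sides zero, and the second one makes the two blocks
      of \<open>J\<close> equal.\<close>
    moreover have "i = j \<or> ?m $ i $ j = 0 \<or> J (x k i) = J (x k j)"
      using assms(5) by auto
    ultimately show ?thesis by auto
  qed
  have "transpose (?M ** blockdiag ?B) $ (i, a) $ (j, b) = (- (?M ** blockdiag ?B)) $ (i, a) $ (j, b)"
    for i j a b
    unfolding transpose_def vec_lambda_beta vector_uminus_component kronecker_mat1_mult_blockdiag
    by (rule *)
  then show "transpose (?M ** blockdiag ?B) = - (?M ** blockdiag ?B)"
    unfolding vec_eq_iff by (metis surj_pair)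
qed

end
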